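(* Let $(X,d)$ be a nonempty complete doubling metric space. Then there exists a doubling measure on $X$.
   Context: In a metric space $(X,d)$, $B(x,t)=\{y\in X : d(x,y)\le t\}$ denotes the closed ball with centre $x\in X$ and radius $t>0$. The metric space $X$ is doubling if there is $N\in\mathbb{N}$ such that for every $x\in X$ and $t>0$ the ball $B(x,2t)$ can be covered by at most $N$ closed balls of radius $t$. A measure on $X$ means a Borel regular outer measure on $X$. A measure $\mu$ on $X$ is called doubling if there is a constant $1\le D<\infty$ such that $0<\mu(B(x,2t))\le D\,\mu(B(x,t))<\infty$ for all $x\in X$ and $t>0$. *)

theory Defs
  imports "HOL-Analysis.Analysis"
begin

context Metric_space
begin

definition doubling :: bool
  where "doubling \<longleftrightarrow>
    (\<exists>N::nat. \<forall>x\<in>M. \<forall>t>0. \<exists>C\<subseteq>M. finite C \<and> card C \<le> N \<and>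
      mcball x (2 * t) \<subseteq> (\<Union>c\<in>C. mcball c t))"

definition borel_subsets :: "'a set set"
  where "borel_subsets = sigma_sets M {U. openin mtopology U}"

text \<open>
  \<^const>\<open>countably_subadditive\<close>, which occurs in \<^const>\<open>outer_measure_space\<close>, only speaks about
  disjoint families. On the full power set, together with monotonicity, this gives countable
  subadditivity for arbitrary sequences of sets.
  The set \<^term>\<open>lambda_system M (Pow M) \<mu>\<close> consists of the Caratheodory measurable subsets of
  the space \<^term>\<open>M\<close>.
\<close>

definition borel_regular_outer_measure :: "('a set \<Rightarrow> ennreal) \<Rightarrow> bool"
  where "borel_regular_outer_measure \<mu> \<longleftrightarrow>
    outer_measure_space (Pow M) \<mu> \<and>
    borel_subsets \<subseteq> lambda_system M (Pow M) \<mu> \<and>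
    (\<forall>A\<subseteq>M. \<exists>B\<in>borel_subsets. A \<subseteq> B \<and> \<mu> B = \<mu> A)"

definition doubling_measure :: "('a set \<Rightarrow> ennreal) \<Rightarrow> bool"
  where "doubling_measure \<mu> \<longleftrightarrow>
    borel_regular_outer_measure \<mu> \<and>
    (\<exists>D::real. 1 \<le> D \<and> (\<forall>x\<in>M. \<forall>t>0.
      0 < \<mu> (mcball x (2 * t)) \<and>
      \<mu> (mcball x (2 * t)) \<le> ennreal D * \<mu> (mcball x t) \<and>
      ennreal D * \<mu> (mcball x t) < \<infinity>))"

end

end

(*
  Fix nested maximal 10^k-separated sets N k (k an integer, larger k being coarser), all containing a
  base point x0. Every point x of N k gets a parent in N (k+1) within distance 10^(k+1), and as its
  parent the point of N (k+1) at distance less than 10^(k+1)/2 if there is one. In particular a point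
  of N (k+1) is its own parent. By doubling, a point has at most K children for some fixed K. Split
  the mass of a point among its children such that every child other than the point itself receives
  the fraction 1/K, while the point itself keeps the rest.

  If two points of N k at distance of order 10^k have different parents, neither is its own parent.
  So up to their lowest common ancestor both receive the fraction 1/K in all but boundedly many steps,
  and their masses are comparable. A random walk down the tree that follows these fractions converges
  by completeness. Its law, started in x0 at the levels 0, 1, 2, ... and renormalised, increases to a
  Borel measure. The mass of a ball of radius about 10^k is comparable to that of a single nearby
  point of N k, which gives the doubling property.
*)

theory Submission
  imports Defs "HOL-Probability.Probability"
begin

section \<open>Nested nets\<close>

definition scale :: "int \<Rightarrow> real"
  where "scale k = 10 powi k"

lemma scale_pos [simp]: "0 < scale k"
  by (simp add: scale_def)

lemma scale_nonneg [simp]: "0 \<le> scale k"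
  using scale_pos[of k] by linarith

lemma scale_add_one: "scale (k + 1) = 10 * scale k"
  by (simp add: scale_def power_int_add)

lemma scale_diff_one: "scale (k - 1) = scale k / 10"
  using scale_add_one[of "k - 1"] by simp

lemma scale_add_nat: "scale (k + int n) = 10 ^ n * scale k"
  by (simp add: scale_def power_int_add)

lemma scale_diff_nat: "scale (k - int n) = (1 / 10) ^ n * scale k"
  using scale_add_nat[of "k - int n" n] by (simp add: field_simps power_divide)

lemma scale_bracket:
  assumes "0 < t"
  obtains k where "scale k \<le> t" "t < 10 * scale k"
proof -
  define k where "k = \<lfloor>log 10 t\<rfloor>"
  have "10 powr (of_int k) \<le> 10 powr (log 10 t)"
    unfolding k_def by (intro powr_mono) auto
  then have 1: "scale k \<le> t"
    using assms by (simp add: scale_def powr_real_of_int')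
  have "10 powr (log 10 t) < 10 powr (of_int (k + 1))"
    unfolding k_def by (intro powr_less_mono) linarith+
  then have "t < scale (k + 1)"
    using assms powr_real_of_int'[of 10 "k + 1"] by (simp add: scale_def)
  then show thesis
    using that 1 by (simp add: scale_add_one)
qed

context Metric_space
begin

section \<open>Maximal separated sets and their nesting over all scales\<close>

abbreviation separated :: "real \<Rightarrow> 'a set \<Rightarrow> bool"
  where "separated r \<equiv> pairwise (\<lambda>x y. r \<le> d x y)"

text \<open>Zorn's lemma applies because two points of the union of a chain already lie in one
  member. A point of \<open>S\<close> at distance at least \<open>r\<close> from a maximal set could
  be adjoined to it.\<close>

lemma separated_extension:
  assumes "0 < r" "A \<subseteq> S" "S \<subseteq> M" "separated r A"
  shows "\<exists>B. A \<subseteq> B \<and> B \<subseteq> S \<and> separated r B \<and> (\<forall>x\<in>S. \<exists>y\<in>B. d x y < r)"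
proof -
  let ?F = "{B. A \<subseteq> B \<and> B \<subseteq> S \<and> separated r B}"
  have "\<exists>B\<in>?F. \<forall>X\<in>?F. B \<subseteq> X \<longrightarrow> X = B"
  proof (rule subset_Zorn_nonempty)
    show "?F \<noteq> {}"
      using assms by blast
    fix \<C> assume ne: "\<C> \<noteq> {}" and ch: "subset.chain ?F \<C>"
    have "separated r (\<Union>\<C>)"
    proof (rule pairwiseI)
      fix x y assume xy: "x \<in> \<Union>\<C>" "y \<in> \<Union>\<C>" "x \<noteq> y"
      then obtain X Y where "X \<in> \<C>" "Y \<in> \<C>" "x \<in> X" "y \<in> Y"
        by blast
      then obtain Z where "Z \<in> \<C>" "x \<in> Z" "y \<in> Z"
        using ch unfolding subset_chain_def by blast
      then show "r \<le> d x y"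
        using ch xy unfolding subset_chain_def pairwise_def by blast
    qed
    then show "\<Union>\<C> \<in> ?F"
      using ne ch unfolding subset_chain_def by blast
  qed
  then obtain B where "B \<in> ?F" and max: "\<And>X. X \<in> ?F \<Longrightarrow> B \<subseteq> X \<Longrightarrow> X = B"
    by (elim bexE) simp
  then have B: "A \<subseteq> B" "B \<subseteq> S" "separated r B"
    by simp_all
  have "\<exists>y\<in>B. d x y < r" if "x \<in> S" for x
  proof (rule ccontr)
    assume far: "\<not> (\<exists>y\<in>B. d x y < r)"
    have "insert x B = B"
      using that far B by (intro max) (auto simp: pairwise_insert not_less commute)
    then show False
      using far that \<open>0 < r\<close> \<open>S \<subseteq> M\<close> mdist_zero[of x] by (metis insertI1 subsetD)
  qed
  then show ?thesis
    by (intro exI[of _ B] conjI ballI B)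
qed

lemma nested_nets:
  assumes "x0 \<in> M"
  shows "\<exists>N :: int \<Rightarrow> 'a set. \<forall>k. N k \<subseteq> M \<and> x0 \<in> N k \<and> N (k + 1) \<subseteq> N k \<and> separated (scale k) (N k) \<and>
    (\<forall>x\<in>N k. \<exists>y\<in>N (k + 1). d x y \<le> scale (k + 1)) \<and> (\<forall>x\<in>M. \<exists>y\<in>N k. d x y \<le> 2 * scale k)"
proof -
  have sep0: "separated r {x0}" for r
    by (rule pairwise_singleton)
  obtain N0 where N0: "{x0} \<subseteq> N0" "N0 \<subseteq> M" "separated (scale 0) N0"
      "\<forall>x\<in>M. \<exists>y\<in>N0. d x y < scale 0"
    using separated_extension[OF scale_pos[of 0] _ subset_refl sep0] assms by auto
  \<comment> \<open>The parameter \<open>c\<close> records the covering radius in units of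
    \<open>scale k\<close>; the two directions of the construction yield different values.\<close>
  define net where "net k c A \<longleftrightarrow> A \<subseteq> M \<and> x0 \<in> A \<and> separated (scale k) A \<and>
      (\<forall>x\<in>M. \<exists>y\<in>A. d x y \<le> c * scale k)" for k and c :: real and A
  \<comment> \<open>Levels above 0: each net is chosen inside the previous one, so covering radii
    add up: \<open>2 * scale n + scale (n + 1)\<close> is 1.2 times \<open>scale (n + 1)\<close>,
    within the constant 2.\<close>
  have "\<exists>f. \<forall>n. (net (int n) 2 (f n) \<and> (n = 0 \<longrightarrow> f n = N0)) \<and>
      (f (Suc n) \<subseteq> f n \<and> (\<forall>x\<in>f n. \<exists>y\<in>f (Suc n). d x y \<le> scale (int n + 1)))"
  proof (rule dependent_nat_choice)
    have "d x y \<le> 2 * scale 0" if "d x y < scale 0" for x y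
      using that scale_pos[of 0] by linarith
    then have "net 0 2 N0"
      unfolding net_def using N0 by (metis insert_subset)
    then show "\<exists>A. net (int 0) 2 A \<and> (0 = (0::nat) \<longrightarrow> A = N0)"
      by auto
  next
    fix A n assume "net (int n) 2 A \<and> (n = 0 \<longrightarrow> A = N0)"
    then have A: "A \<subseteq> M" "x0 \<in> A" "\<And>x. x \<in> M \<Longrightarrow> \<exists>y\<in>A. d x y \<le> 2 * scale (int n)"
      by (auto simp: net_def)
    have "{x0} \<subseteq> A"
      using A by simp
    from separated_extension[OF scale_pos[of "int n + 1"] this A(1) sep0]
    obtain B where B: "{x0} \<subseteq> B" "B \<subseteq> A" "separated (scale (int n + 1)) B"
        "\<forall>x\<in>A. \<exists>y\<in>B. d x y < scale (int n + 1)"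
      by (elim exE conjE)
    have "\<exists>y\<in>B. d x y \<le> 2 * scale (int n + 1)" if "x \<in> M" for x
    proof -
      from A(3)[OF that] obtain y where y: "y \<in> A" "d x y \<le> 2 * scale (int n)"
        by (elim bexE)
      from bspec[OF B(4) y(1)] obtain z where z: "z \<in> B" "d y z < scale (int n + 1)"
        by (elim bexE)
      have "d x z \<le> d x y + d y z"
        using y(1) z(1) A(1) B(2) that by (meson subsetD triangle)
      then show ?thesis
        using y(2) z scale_pos[of "int n"] unfolding scale_add_one by (intro bexI[of _ z]) linarith+
    qed
    then have "net (int (Suc n)) 2 B"
      using A B(1-3) by (simp add: net_def add.commute subset_trans)
    then show "\<exists>B. (net (int (Suc n)) 2 B \<and> (Suc n = 0 \<longrightarrow> B = N0)) \<and>
        B \<subseteq> A \<and> (\<forall>x\<in>A. \<exists>y\<in>B. d x y \<le> scale (int n + 1))"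
      using B(2,4) by (intro exI[of _ B]) (simp, metis less_imp_le)
  qed
  then obtain f where f: "\<And>n. net (int n) 2 (f n)" "f 0 = N0" "\<And>n. f (Suc n) \<subseteq> f n"
    "\<And>n x. x \<in> f n \<Longrightarrow> \<exists>y\<in>f (Suc n). d x y \<le> scale (int n + 1)"
    by blast
  \<comment> \<open>Levels below 0: each finer net extends the previous one within all of
    \<open>M\<close>, which gives the constant 1. The clauses for \<open>n = 0\<close> make both
    sequences start from \<open>N0\<close>.\<close>
  have "\<exists>g. \<forall>n. (net (- int n) 1 (g n) \<and> (n = 0 \<longrightarrow> g n = N0)) \<and> g n \<subseteq> g (Suc n)"
  proof (rule dependent_nat_choice)
    have "net 0 1 N0"
      unfolding net_def using N0 by (metis insert_subset less_imp_le mult_1)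
    then show "\<exists>A. net (- int 0) 1 A \<and> (0 = (0::nat) \<longrightarrow> A = N0)"
      by auto
  next
    fix A n assume "net (- int n) 1 A \<and> (n = 0 \<longrightarrow> A = N0)"
    then have A: "A \<subseteq> M" "x0 \<in> A" "separated (scale (- int n)) A"
      by (auto simp: net_def)
    have "scale (- int (Suc n)) = scale (- int n) / 10"
      using scale_diff_one[of "- int n"] by (simp add: minus_diff_commute)
    then have "scale (- int (Suc n)) \<le> scale (- int n)"
      using scale_pos[of "- int n"] by linarith
    with A(3) have "separated (scale (- int (Suc n))) A"
      unfolding pairwise_def by (meson order_trans)
    from separated_extension[OF scale_pos[of "- int (Suc n)"] A(1) subset_refl this]
    obtain B where B: "A \<subseteq> B" "B \<subseteq> M" "separated (scale (- int (Suc n))) B"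
        "\<forall>x\<in>M. \<exists>y\<in>B. d x y < scale (- int (Suc n))"
      by (elim exE conjE)
    then have "net (- int (Suc n)) 1 B"
      using A(2) unfolding net_def mult_1 by (meson less_imp_le subsetD)
    then show "\<exists>B. (net (- int (Suc n)) 1 B \<and> (Suc n = 0 \<longrightarrow> B = N0)) \<and> A \<subseteq> B"
      using B(1) by auto
  qed
  then obtain g where g: "\<And>n. net (- int n) 1 (g n)" "g 0 = N0" "\<And>n. g n \<subseteq> g (Suc n)"
    by metis
  define N where "N k = (if 0 \<le> k then f (nat k) else g (nat (- k)))" for k
  have N_pos: "N (int n) = f n" for n
    by (simp add: N_def)
  have N_neg: "N (- int n) = g n" for n
    by (cases n) (simp_all add: N_def f g nat_add_distrib)
  have net2: "net k 2 (N k)" for k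
  proof (cases k rule: int_cases2)
    case (nonneg n)
    then show ?thesis
      using f by (simp add: N_pos)
  next
    case (nonpos n)
    have "\<exists>y\<in>g n. d x y \<le> 2 * scale (- int n)" if x: "x \<in> M" for x
    proof -
      obtain y where "y \<in> g n" "d x y \<le> 1 * scale (- int n)"
        using g(1)[of n] x unfolding net_def by meson
      then show ?thesis
        using scale_pos[of "- int n"] by (intro bexI[of _ y]) linarith+
    qed
    then show ?thesis
      using nonpos g(1)[of n] by (simp add: net_def N_neg)
  qed
  have step: "N (k + 1) \<subseteq> N k \<and> (\<forall>x\<in>N k. \<exists>y\<in>N (k + 1). d x y \<le> scale (k + 1))" for k
  proof (cases "0 \<le> k")
    case True
    then obtain n where "k = int n"
      by (metis nonneg_int_cases)
    moreover have "N (int n + 1) = f (Suc n)"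
      using N_pos[of "Suc n"] by (simp add: add.commute)
    ultimately show ?thesis
      using f by (simp add: N_pos)
  next
    case False
    \<comment> \<open>With \<open>k + 1 = - int n\<close> the finer net is \<open>g (Suc n)\<close>
      and the coarser one is \<open>g n\<close>, whose covering constant 1 is the bound required for
      parents.\<close>
    define n where "n = nat (- (k + 1))"
    have k: "k = - int (Suc n)" "k + 1 = - int n"
      using False by (auto simp: n_def)
    have "N k = g (Suc n)" "N (k + 1) = g n"
      unfolding k(2) unfolding k(1) N_neg by (rule refl)+
    moreover have "g (Suc n) \<subseteq> M" "\<forall>x\<in>M. \<exists>y\<in>g n. d x y \<le> 1 * scale (k + 1)"
      using g(1)[of n] g(1)[of "Suc n"] unfolding net_def k(2) by simp_all
    ultimately show ?thesis
      using g(3)[of n] by (metis mult_1 subsetD)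
  qed
  show ?thesis
  proof (intro exI[of _ N] allI)
    fix k
    show "N k \<subseteq> M \<and> x0 \<in> N k \<and> N (k + 1) \<subseteq> N k \<and> separated (scale k) (N k) \<and>
        (\<forall>x\<in>N k. \<exists>y\<in>N (k + 1). d x y \<le> scale (k + 1)) \<and> (\<forall>x\<in>M. \<exists>y\<in>N k. d x y \<le> 2 * scale k)"
      using step[of k] net2[of k] unfolding net_def by (elim conjE, intro conjI)
  qed
qed

section \<open>Cardinality of separated sets in balls of a doubling space\<close>

lemma doubling_iterated_cover:
  assumes N: "\<And>x t. x \<in> M \<Longrightarrow> 0 < t \<Longrightarrow>
      \<exists>C\<subseteq>M. finite C \<and> card C \<le> N \<and> mcball x (2 * t) \<subseteq> (\<Union>c\<in>C. mcball c t)"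
    and "x \<in> M" "0 < t"
  shows "\<exists>C\<subseteq>M. finite C \<and> card C \<le> N ^ m \<and> mcball x (2 ^ m * t) \<subseteq> (\<Union>c\<in>C. mcball c t)"
  using \<open>x \<in> M\<close>
proof (induction m arbitrary: x)
  case 0
  then show ?case
    by (intro exI[of _ "{x}"]) auto
next
  case (Suc m)
  obtain C where C: "C \<subseteq> M" "finite C" "card C \<le> N"
      "mcball x (2 * (2 ^ m * t)) \<subseteq> (\<Union>c\<in>C. mcball c (2 ^ m * t))"
    using N[of x "2 ^ m * t"] Suc.prems \<open>0 < t\<close> by (metis mult_pos_pos zero_less_numeral zero_less_power)
  from Suc.IH C(1) obtain E where E: "\<And>c. c \<in> C \<Longrightarrow> E c \<subseteq> M \<and> finite (E c) \<and> card (E c) \<le> N ^ m \<and>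
      mcball c (2 ^ m * t) \<subseteq> (\<Union>e\<in>E c. mcball e t)"
    by (metis (no_types) subsetD)
  have "card (\<Union>c\<in>C. E c) \<le> (\<Sum>c\<in>C. card (E c))"
    by (rule card_UN_le) fact
  also have "\<dots> \<le> (\<Sum>c\<in>C. N ^ m)"
    using E by (intro sum_mono) auto
  also have "\<dots> \<le> N ^ Suc m"
    using C by simp
  finally have "card (\<Union>c\<in>C. E c) \<le> N ^ Suc m" .
  moreover have "mcball x (2 ^ Suc m * t) \<subseteq> (\<Union>e\<in>(\<Union>c\<in>C. E c). mcball e t)"
  proof
    fix y assume "y \<in> mcball x (2 ^ Suc m * t)"
    then obtain c where "c \<in> C" "y \<in> mcball c (2 ^ m * t)"
      using C(4) by (auto simp: mult.assoc)
    then show "y \<in> (\<Union>e\<in>(\<Union>c\<in>C. E c). mcball e t)"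
      using E[of c] by blast
  qed
  ultimately show ?case
    using C E by (intro exI[of _ "\<Union>c\<in>C. E c"] conjI) (blast | simp)+
qed

text \<open>A ball of radius \<open>r / 4\<close> contains at most one point of an
  \<open>r\<close>-separated set, so the number of balls in a cover bounds the number of
  points.\<close>

lemma doubling_separated_card:
  assumes doubling
  shows "\<exists>K. \<forall>r z S. 0 < r \<longrightarrow> z \<in> M \<longrightarrow> S \<subseteq> mcball z (100 * r) \<longrightarrow> separated r S \<longrightarrow>
    finite S \<and> card S \<le> K"
proof -
  obtain N where N: "\<And>x t. x \<in> M \<Longrightarrow> 0 < t \<Longrightarrow>
      \<exists>C\<subseteq>M. finite C \<and> card C \<le> N \<and> mcball x (2 * t) \<subseteq> (\<Union>c\<in>C. mcball c t)"
    using assms unfolding doubling_def by blast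
  have "finite S \<and> card S \<le> N ^ 9"
    if r: "0 < r" and z: "z \<in> M" and S: "S \<subseteq> mcball z (100 * r)" "separated r S" for r z S
  proof -
    \<comment> \<open>Nine halvings suffice: \<open>2 ^ 9 / 4 = 128\<close> exceeds 100.\<close>
    obtain C where C: "C \<subseteq> M" "finite C" "card C \<le> N ^ 9"
        "mcball z (2 ^ 9 * (r / 4)) \<subseteq> (\<Union>c\<in>C. mcball c (r / 4))"
      using doubling_iterated_cover[OF N z, of "r / 4" 9] r by auto
    have "S \<subseteq> mcball z (2 ^ 9 * (r / 4))"
      using S(1) r by auto
    then have "\<forall>s\<in>S. \<exists>c\<in>C. s \<in> mcball c (r / 4)"
      using C(4) by blast
    then obtain h where h: "\<And>s. s \<in> S \<Longrightarrow> h s \<in> C \<and> s \<in> mcball (h s) (r / 4)"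
      by metis
    have inj: "inj_on h S"
    proof (rule inj_onI, rule ccontr)
      fix s u assume su: "s \<in> S" "u \<in> S" "h s = h u" "s \<noteq> u"
      have "d s u \<le> d s (h s) + d (h s) u"
        using h[OF su(1)] h[OF su(2)] by (intro triangle) auto
      also have "\<dots> \<le> r / 4 + r / 4"
        using h[OF su(1)] h[OF su(2)] su(3) commute[of s "h s"] by auto
      finally show False
        using S(2) su r unfolding pairwise_def by fastforce
    qed
    moreover have "h ` S \<subseteq> C"
      using h by auto
    ultimately show ?thesis
      using C by (meson card_inj_on_le finite_imageD finite_subset le_trans)
  qed
  then show ?thesis
    by (intro exI[of _ "N ^ 9"] allI impI)
qed

end


section \<open>Weights on the tree of net points\<close>

text \<open>Doubling is represented by the uniform bound \<open>K\<close> on net points in a ball of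
  radius \<open>100 * scale k\<close>. The same \<open>K\<close> later serves as the number of
  digits that drive the random walk.\<close>

locale net_tree = Metric_space M d
  for M :: "'a set" and d :: "'a \<Rightarrow> 'a \<Rightarrow> real" +
  fixes x0 :: 'a and N :: "int \<Rightarrow> 'a set" and K :: nat
  assumes net_subset: "N k \<subseteq> M"
    and base_in_net: "x0 \<in> N k"
    and net_nested: "N (k + 1) \<subseteq> N k"
    and net_separated: "separated (scale k) (N k)"
    and parent_exists: "x \<in> N k \<Longrightarrow> \<exists>y\<in>N (k + 1). d x y \<le> scale (k + 1)"
    and net_cover: "x \<in> M \<Longrightarrow> \<exists>y\<in>N k. d x y \<le> 2 * scale k"
    and finite_net_ball: "x \<in> M \<Longrightarrow> finite (N k \<inter> mcball x (100 * scale k))"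
    and card_net_ball: "x \<in> M \<Longrightarrow> card (N k \<inter> mcball x (100 * scale k)) \<le> K"
    and complete: mcomplete
begin

lemma net_in_space: "x \<in> N k \<Longrightarrow> x \<in> M"
  using net_subset by (rule subsetD)

lemma net_eqI:
  assumes "x \<in> N k" "y \<in> N k" "d x y < scale k"
  shows "x = y"
  using pairwiseD[OF net_separated assms(1,2)] assms(3) by linarith

lemma K_pos: "0 < K"
proof -
  have "x0 \<in> N 0 \<inter> mcball x0 (100 * scale 0)"
    using base_in_net net_in_space[OF base_in_net] by simp
  then have "0 < card (N 0 \<inter> mcball x0 (100 * scale 0))"
    using finite_net_ball[OF net_in_space[OF base_in_net]] card_gt_0_iff by blast
  then show ?thesis
    using card_net_ball[OF net_in_space[OF base_in_net], of 0] by linarith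
qed

section \<open>Parents and children\<close>

definition parent :: "int \<Rightarrow> 'a \<Rightarrow> 'a"
  where "parent k x = (SOME y. y \<in> N (k + 1) \<and> d x y \<le> scale (k + 1) \<and>
    (\<forall>z\<in>N (k + 1). d x z < scale (k + 1) / 2 \<longrightarrow> z = y))"

text \<open>Two points of \<open>N (k + 1)\<close> at distance less than
  \<open>scale (k + 1) / 2\<close> from \<open>x\<close> would violate the separation of that net.
  So there is at most one, and the choice in \<open>parent\<close> can be made.\<close>

lemma parent:
  assumes "x \<in> N k"
  shows parent_in_net: "parent k x \<in> N (k + 1)"
    and parent_dist: "d x (parent k x) \<le> scale (k + 1)"
    and parent_eq: "z \<in> N (k + 1) \<Longrightarrow> d x z < scale (k + 1) / 2 \<Longrightarrow> parent k x = z"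
proof -
  have "\<exists>y. y \<in> N (k + 1) \<and> d x y \<le> scale (k + 1) \<and>
      (\<forall>z\<in>N (k + 1). d x z < scale (k + 1) / 2 \<longrightarrow> z = y)"
  proof (cases "\<exists>y\<in>N (k + 1). d x y < scale (k + 1) / 2")
    case True
    then obtain y where y: "y \<in> N (k + 1)" "d x y < scale (k + 1) / 2"
      by (elim bexE)
    have "z = y" if z: "z \<in> N (k + 1)" "d x z < scale (k + 1) / 2" for z
    proof (rule net_eqI[OF z(1) y(1)])
      have "d z y \<le> d z x + d x y"
        using z(1) y(1) assms by (intro triangle net_in_space)
      then show "d z y < scale (k + 1)"
        using y(2) z(2) commute[of x z] by linarith
    qed
    moreover have "d x y \<le> scale (k + 1)"
      using y(2) scale_pos[of "k + 1"] by linarith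
    ultimately show ?thesis
      using y(1) by metis
  next
    case False
    then show ?thesis
      using parent_exists[OF assms] by metis
  qed
  then have *: "parent k x \<in> N (k + 1) \<and> d x (parent k x) \<le> scale (k + 1) \<and>
      (\<forall>z\<in>N (k + 1). d x z < scale (k + 1) / 2 \<longrightarrow> z = parent k x)"
    unfolding parent_def by (rule someI_ex)
  show "parent k x \<in> N (k + 1)" "d x (parent k x) \<le> scale (k + 1)"
    by (rule conjunct1[OF *], rule conjunct1[OF conjunct2[OF *]])
  show "parent k x = z" if "z \<in> N (k + 1)" "d x z < scale (k + 1) / 2"
    using bspec[OF conjunct2[OF conjunct2[OF *]] that(1)] that(2) by simp
qed

lemma parent_self:
  assumes "x \<in> N (k + 1)"
  shows "parent k x = x"
proof (rule parent_eq)
  show "x \<in> N k"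
    using assms net_nested by (metis subsetD)
  show "d x x < scale (k + 1) / 2"
    using net_in_space[OF assms] by simp
qed fact

definition children :: "int \<Rightarrow> 'a \<Rightarrow> 'a set"
  where "children k y = {x \<in> N k. parent k x = y}"

text \<open>Children of \<open>y\<close> lie within \<open>scale (k + 1) = 10 * scale k\<close> of
  \<open>y\<close>, hence in a ball to which the bound \<open>K\<close> applies.\<close>

lemma
  assumes "y \<in> N (k + 1)"
  shows finite_children: "finite (children k y)"
    and card_children: "card (children k y) \<le> K"
    and self_in_children: "y \<in> children k y"
proof -
  have y: "y \<in> M"
    using assms by (rule net_in_space)
  have sub: "children k y \<subseteq> N k \<inter> mcball y (100 * scale k)"
  proof
    fix x assume "x \<in> children k y"
    then have x: "x \<in> N k" "parent k x = y"
      by (simp_all add: children_def)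
    then have "d y x \<le> 100 * scale k"
      using parent_dist[OF x(1)] commute[of x y] scale_pos[of k] unfolding scale_add_one x(2) by linarith
    then show "x \<in> N k \<inter> mcball y (100 * scale k)"
      using x y net_in_space[OF x(1)] by simp
  qed
  then show "finite (children k y)"
    using finite_net_ball[OF y] by (rule finite_subset)
  show "card (children k y) \<le> K"
    using card_mono[OF finite_net_ball[OF y] sub] card_net_ball[OF y, of k] by linarith
  show "y \<in> children k y"
    using assms net_nested[of k] parent_self[OF assms] by (auto simp: children_def)
qed

text \<open>
  Every digit \<open>u < K\<close> selects a child of \<open>y\<close>. A child other than \<open>y\<close> itself is selected by exactly
  one digit, and \<open>y\<close> absorbs all the digits that are left over.
\<close>

definition child :: "int \<Rightarrow> 'a \<Rightarrow> nat \<Rightarrow> 'a"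
  where "child k y u = (if u < card (children k y) then from_nat_into (children k y) u else y)"

lemma child_in_children:
  assumes "y \<in> N (k + 1)"
  shows "child k y u \<in> children k y"
  using self_in_children[OF assms] from_nat_into[of "children k y" u] by (auto simp: child_def)

lemma
  assumes "y \<in> N (k + 1)"
  shows child_in_net: "child k y u \<in> N k"
    and parent_child: "parent k (child k y u) = y"
  using child_in_children[OF assms, of u] by (simp_all add: children_def)

section \<open>Probability that a uniformly random digit selects a given child\<close>

definition prob :: "int \<Rightarrow> 'a \<Rightarrow> real"
  where "prob k x = card {u \<in> {..<K}. child k (parent k x) u = x} / K"

lemma prob_le_one: "prob k x \<le> 1"
proof -
  have "card {u \<in> {..<K}. child k (parent k x) u = x} \<le> card {..<K}"
    by (intro card_mono) auto
  then show ?thesis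
    using K_pos by (simp add: prob_def)
qed

text \<open>On the digits below the number of children, \<open>from_nat_into\<close> is a bijection
  onto the children; as there are at most \<open>K\<close> children, the digit found is below
  \<open>K\<close>.\<close>

lemma digit_of_child:
  assumes "x \<in> N k"
  shows "\<exists>u<K. {v. v < card (children k (parent k x)) \<and> child k (parent k x) v = x} = {u}"
proof -
  let ?C = "children k (parent k x)"
  have pn: "parent k x \<in> N (k + 1)"
    using assms by (rule parent_in_net)
  have bij: "bij_betw (from_nat_into ?C) {..<card ?C} ?C"
    using finite_children[OF pn] by (rule bij_betw_from_nat_into_finite)
  have "x \<in> ?C"
    using assms by (simp add: children_def)
  then have "x \<in> from_nat_into ?C ` {..<card ?C}"
    unfolding bij_betw_imp_surj_on[OF bij] .
  then obtain u where u: "u < card ?C" "from_nat_into ?C u = x"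
    by (elim imageE) simp
  have inj: "v = u" if "v < card ?C" "child k (parent k x) v = x" for v
    using that u inj_onD[OF bij_betw_imp_inj_on[OF bij], of v u] by (simp add: child_def)
  have "u < K" "child k (parent k x) u = x"
    using u card_children[OF pn] by (simp_all add: child_def)
  moreover have "{v. v < card ?C \<and> child k (parent k x) v = x} = {u}"
    using inj u(1) calculation(2) by blast
  ultimately show ?thesis
    by (intro exI[of _ u] conjI)
qed

lemma prob_ge:
  assumes "x \<in> N k"
  shows "1 / K \<le> prob k x"
proof -
  from digit_of_child[OF assms] obtain u where "u < K"
    and u: "{v. v < card (children k (parent k x)) \<and> child k (parent k x) v = x} = {u}"
    by (elim exE conjE)
  have "u \<in> {v. v < card (children k (parent k x)) \<and> child k (parent k x) v = x}"
    unfolding u by (rule singletonI)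
  then have "u \<in> {u \<in> {..<K}. child k (parent k x) u = x}"
    using \<open>u < K\<close> by simp
  then have "{u \<in> {..<K}. child k (parent k x) u = x} \<noteq> {}"
    by (metis empty_iff)
  then have "1 \<le> card {u \<in> {..<K}. child k (parent k x) u = x}"
    by (simp add: Suc_le_eq card_gt_0_iff)
  then show ?thesis
    unfolding prob_def by (intro divide_right_mono) simp_all
qed

lemma prob_pos: "x \<in> N k \<Longrightarrow> 0 < prob k x"
  using less_le_trans[OF _ prob_ge] K_pos by simp

text \<open>The left-over digits all select the parent, which differs from \<open>x\<close> here, so
  exactly one digit selects \<open>x\<close>.\<close>

lemma prob_noncentral:
  assumes "x \<in> N k" "x \<notin> N (k + 1)"
  shows "prob k x = 1 / K"
proof -
  from digit_of_child[OF assms(1)] obtain u where "u < K"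
    and u: "{v. v < card (children k (parent k x)) \<and> child k (parent k x) v = x} = {u}"
    by (elim exE conjE)
  have "parent k x \<noteq> x"
    using parent_in_net[OF assms(1)] assms(2) by auto
  then have "v < card (children k (parent k x))" if "child k (parent k x) v = x" for v
    using that unfolding child_def by (cases "v < card (children k (parent k x))") simp_all
  then have "{v \<in> {..<K}. child k (parent k x) v = x} =
      {v. v < card (children k (parent k x)) \<and> child k (parent k x) v = x} \<inter> {..<K}"
    by (intro equalityI subsetI) simp_all
  also have "\<dots> = {u}"
    unfolding u using \<open>u < K\<close> by simp
  finally have "{v \<in> {..<K}. child k (parent k x) v = x} = {u}" .
  then show ?thesis
    by (simp add: prob_def)
qed

section \<open>Ancestors and the comparison of weights\<close>

primrec anc :: "nat \<Rightarrow> int \<Rightarrow> 'a \<Rightarrow> 'a"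
  where "anc 0 k x = x"
  | "anc (Suc n) k x = anc n (k + 1) (parent k x)"

text \<open>For a net point \<open>x\<close> this is the probability that the walk started at
  \<open>anc n k x\<close>, \<open>n\<close> levels above, is at \<open>x\<close> when it reaches
  level \<open>k\<close>.\<close>

primrec weight :: "nat \<Rightarrow> int \<Rightarrow> 'a \<Rightarrow> real"
  where "weight 0 k x = 1"
  | "weight (Suc n) k x = prob k x * weight n (k + 1) (parent k x)"

lemma weight_pos: "x \<in> N k \<Longrightarrow> 0 < weight n k x"
  by (induction n arbitrary: k x) (simp_all add: prob_pos parent_in_net)

lemma weight_nonneg: "x \<in> N k \<Longrightarrow> 0 \<le> weight n k x"
  using weight_pos[of x k n] by linarith

lemma weight_Suc_le:
  assumes "x \<in> N k"
  shows "weight (Suc n) k x \<le> weight n (k + 1) (parent k x)"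
  using mult_right_mono[OF prob_le_one[of k x] weight_nonneg[OF parent_in_net[OF assms], of n]] by simp

lemma weight_Suc_ge:
  assumes "x \<in> N k"
  shows "weight n (k + 1) (parent k x) \<le> K * weight (Suc n) k x"
proof -
  have "1 \<le> K * prob k x"
    using prob_ge[OF assms] K_pos by (simp add: field_simps)
  from mult_right_mono[OF this weight_nonneg[OF parent_in_net[OF assms], of n]] show ?thesis
    by simp
qed

text \<open>The detour through \<open>x\<close> and \<open>y\<close> adds two parent distances, and
  the change of unit divides \<open>c\<close> by 10. Iterating \<open>c / 10 + 2\<close> drives
  every constant towards 20/9.\<close>

lemma dist_parent_le:
  assumes "x \<in> N k" "y \<in> N k" "d x y \<le> c * scale k"
  shows "d (parent k x) (parent k y) \<le> (c / 10 + 2) * scale (k + 1)"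
proof -
  have M: "x \<in> M" "y \<in> M" "parent k x \<in> M" "parent k y \<in> M"
    using assms(1,2) by (auto intro: net_in_space parent_in_net)
  have "d (parent k x) (parent k y) \<le> d (parent k x) x + d x (parent k y)"
    using M by (intro triangle)
  also have "d x (parent k y) \<le> d x y + d y (parent k y)"
    using M by (intro triangle)
  also have "d (parent k x) x + (d x y + d y (parent k y)) \<le> scale (k + 1) + (c * scale k + scale (k + 1))"
    using parent_dist[OF assms(1)] parent_dist[OF assms(2)] assms(3) commute[of x "parent k x"] by linarith
  also have "\<dots> = (c / 10 + 2) * scale (k + 1)"
    unfolding scale_add_one by (simp add: algebra_simps)
  finally show ?thesis
    by simp
qed

text \<open>
  If the parents of two nearby net points differ, then neither point is its own parent, as otherwise
  it would also be the parent of the other one. So below the lowest common ancestor the two branches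
  pick up the same factor \<open>1 / K\<close> in every step.
\<close>

lemma weight_le_near:
  assumes "x \<in> N k" "y \<in> N k" "d x y \<le> 4 * scale k" "anc n k x = anc n k y"
  shows "weight n k x \<le> K * weight n k y"
  using assms
proof (induction n arbitrary: k x y)
  case 0
  then show ?case
    using K_pos by simp
next
  case (Suc n)
  note px = parent_in_net[OF Suc.prems(1)] and py = parent_in_net[OF Suc.prems(2)]
  show ?case
  proof (cases "parent k x = parent k y")
    case True
    then show ?thesis
      using weight_Suc_le[OF Suc.prems(1), of n] weight_Suc_ge[OF Suc.prems(2), of n] by simp
  next
    case False
    have "x \<notin> N (k + 1)"
    proof
      assume x: "x \<in> N (k + 1)"
      \<comment> \<open>Since \<open>4 * scale k < 5 * scale k = scale (k + 1) / 2\<close>, the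
        point \<open>x\<close> would be the parent of \<open>y\<close> as well as its own.\<close>
      have "d y x < scale (k + 1) / 2"
        using Suc.prems(3) commute[of x y] scale_pos[of k] unfolding scale_add_one by linarith
      then show False
        using parent_self[OF x] parent_eq[OF Suc.prems(2) x] False by simp
    qed
    then have "weight (Suc n) k x = weight n (k + 1) (parent k x) / K"
      using prob_noncentral[OF Suc.prems(1)] by simp
    \<comment> \<open>The factor \<open>1 / K\<close> picked up by \<open>x\<close> cancels the
      constant of the induction hypothesis, and the lower bound for the step of \<open>y\<close>
      restores it. So the constant does not grow with \<open>n\<close>.\<close>
    also have "\<dots> \<le> K * weight n (k + 1) (parent k y) / K"
    proof (intro divide_right_mono Suc.IH px py)
      have "d (parent k x) (parent k y) \<le> (4 / 10 + 2) * scale (k + 1)"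
        using Suc.prems(1-3) by (rule dist_parent_le)
      \<comment> \<open>The distance bound reproduces itself one level up:
        \<open>4 / 10 + 2 = 2.4\<close>.\<close>
      also have "\<dots> \<le> 4 * scale (k + 1)"
        by (intro mult_right_mono) simp_all
      finally show "d (parent k x) (parent k y) \<le> 4 * scale (k + 1)" .
    qed (use Suc.prems(4) in simp_all)
    also have "\<dots> = weight n (k + 1) (parent k y)"
      using K_pos by simp
    also have "\<dots> \<le> K * weight (Suc n) k y"
      using Suc.prems(2) by (rule weight_Suc_ge)
    finally show ?thesis .
  qed
qed

text \<open>Going up one level replaces \<open>c\<close> by \<open>c / 10 + 2\<close> at the cost of
  a factor \<open>K\<close>: the weight of \<open>x\<close> does not decrease, and that of
  \<open>y\<close> grows at most by the factor \<open>K\<close>. For \<open>n = 0\<close> both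
  weights are 1.\<close>

lemma weight_le_lift:
  assumes hyp: "\<And>n k x y. x \<in> N k \<Longrightarrow> y \<in> N k \<Longrightarrow> d x y \<le> (c / 10 + 2) * scale k \<Longrightarrow>
      anc n k x = anc n k y \<Longrightarrow> weight n k x \<le> L * weight n k y"
    and "1 \<le> L" and xy: "x \<in> N k" "y \<in> N k" "d x y \<le> c * scale k" "anc n k x = anc n k y"
  shows "weight n k x \<le> L * K * weight n k y"
proof (cases n)
  case 0
  have "1 * 1 \<le> L * K"
    using \<open>1 \<le> L\<close> K_pos by (intro mult_mono) auto
  then show ?thesis
    using 0 by simp
next
  case (Suc m)
  have "weight n k x \<le> weight m (k + 1) (parent k x)"
    unfolding Suc using xy(1) by (rule weight_Suc_le)
  also have "\<dots> \<le> L * weight m (k + 1) (parent k y)"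
    using xy(4) by (intro hyp parent_in_net dist_parent_le xy) (simp add: Suc)
  also have "\<dots> \<le> L * (K * weight n k y)"
    unfolding Suc using \<open>1 \<le> L\<close> by (intro mult_left_mono weight_Suc_ge xy) simp
  finally show ?thesis
    by (simp add: mult.assoc)
qed

text \<open>Two lifts turn 100 into 12 and then into 3.2, which is below the constant 4 of
  \<open>weight_le_near\<close>. Each of the three steps contributes a factor
  \<open>K\<close>.\<close>

lemma weight_comparable:
  assumes "x \<in> N k" "y \<in> N k" "d x y \<le> 100 * scale k" "anc n k x = anc n k y"
  shows "weight n k x \<le> real K ^ 3 * weight n k y"
proof -
  have K1: "1 \<le> real K"
    using K_pos by simp
  have *: "weight n k x \<le> real K * real K * weight n k y"
    if xy: "x \<in> N k" "y \<in> N k" "d x y \<le> (100 / 10 + 2) * scale k" "anc n k x = anc n k y" for n k x y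
  proof (rule weight_le_lift[OF _ K1 xy])
    fix n k x y
    assume h: "x \<in> N k" "y \<in> N k" "d x y \<le> ((100 / 10 + 2) / 10 + 2) * scale k" "anc n k x = anc n k y"
    have "((100 / 10 + 2) / 10 + 2) * scale k \<le> 4 * scale k"
      by (intro mult_right_mono) simp_all
    with h(3) have "d x y \<le> 4 * scale k"
      by (rule order_trans)
    with h show "weight n k x \<le> K * weight n k y"
      by (intro weight_le_near)
  qed
  have "weight n k x \<le> real K * real K * real K * weight n k y"
    by (rule weight_le_lift[OF * mult_ge1_I[OF K1 K1] assms])
  then show ?thesis
    by (simp add: power3_eq_cube)
qed

section \<open>Every net point eventually descends from the base point\<close>

lemma anc_base: "anc n k x0 = x0"
  by (induction n arbitrary: k) (simp_all add: parent_self base_in_net)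

lemma anc_add: "anc (m + n) k x = anc n (k + int m) (anc m k x)"
  by (induction m arbitrary: k x) (simp_all add: algebra_simps)

text \<open>
  Passing to the parent contracts the distance to \<open>x0\<close>, measured in units of the current scale, until
  \<open>x0\<close> becomes the parent.
\<close>

lemma ex_anc_base:
  assumes "x \<in> N k" "d x x0 < 5 * 3 ^ m * scale k"
  shows "\<exists>n. anc n k x = x0"
  using assms
proof (induction m arbitrary: k x)
  case 0
  then have "parent k x = x0"
    by (intro parent_eq base_in_net) (simp_all add: scale_add_one)
  then show ?case
    by (intro exI[of _ "Suc 0"]) simp
next
  case (Suc m)
  show ?case
  proof (cases "d x x0 < 5 * scale k")
    case True
    then have "parent k x = x0"
      using Suc.prems(1) by (intro parent_eq base_in_net) (simp_all add: scale_add_one)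
    then show ?thesis
      by (intro exI[of _ "Suc 0"]) simp
  next
    case False
    note px = parent_in_net[OF Suc.prems(1)]
    have "d (parent k x) x0 \<le> d (parent k x) x + d x x0"
      using Suc.prems(1) px base_in_net by (intro triangle net_in_space)
    also have "\<dots> \<le> 10 * scale k + d x x0"
      using parent_dist[OF Suc.prems(1)] commute[of x "parent k x"] by (simp add: scale_add_one)
    \<comment> \<open>In this case \<open>5 * scale k\<close> is at most the distance to
      \<open>x0\<close>, so \<open>10 * scale k\<close> is at most twice that distance.\<close>
    also have "\<dots> \<le> 3 * d x x0"
      using False by linarith
    also have "\<dots> < 3 * (5 * 3 ^ Suc m * scale k)"
      using Suc.prems(2) by (rule mult_strict_left_mono) simp
    \<comment> \<open>The distance at most triples while the unit grows tenfold:
      \<open>3 * 3 ^ Suc m = 9 * 3 ^ m\<close>, and 9 is below 10.\<close>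
    also have "\<dots> \<le> 5 * 3 ^ m * scale (k + 1)"
      using mult_nonneg_nonneg[OF zero_le_power scale_nonneg, of "3::real" m k] by (simp add: scale_add_one)
    finally have "d (parent k x) x0 < 5 * 3 ^ m * scale (k + 1)" .
    from Suc.IH[OF px this] obtain n where "anc n (k + 1) (parent k x) = x0"
      by (elim exE)
    then show ?thesis
      by (intro exI[of _ "Suc n"]) simp
  qed
qed

text \<open>Some power of 3 exceeds the rescaled distance to \<open>x0\<close>; once reached,
  \<open>x0\<close> is never left, being its own parent at every level.\<close>

lemma eventually_anc_base:
  assumes "x \<in> N k"
  shows "\<forall>\<^sub>F n in sequentially. anc n k x = x0"
proof -
  obtain m where "d x x0 / (5 * scale k) < 3 ^ m"
    using real_arch_pow[of 3 "d x x0 / (5 * scale k)"] by auto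
  then have "d x x0 < 5 * 3 ^ m * scale k"
    by (simp add: field_simps)
  with assms obtain n where n: "anc n k x = x0"
    using ex_anc_base by metis
  have "anc j k x = x0" if "n \<le> j" for j
    using anc_add[of n "j - n" k x] that n anc_base by simp
  then show ?thesis
    unfolding eventually_sequentially by metis
qed

end


section \<open>Random descending paths\<close>

context Metric_space
begin

section \<open>The Borel sigma-algebra as a measurable space\<close>

definition borel_algebra :: "'a measure"
  where "borel_algebra = sigma M {U. openin mtopology U}"

lemma openin_in_Pow: "{U. openin mtopology U} \<subseteq> Pow M"
  using openin_subset[of mtopology] by auto

lemma space_borel_algebra [simp]: "space borel_algebra = M"
  by (simp add: borel_algebra_def space_measure_of openin_in_Pow)

lemma sets_borel_algebra [simp]: "sets borel_algebra = borel_subsets"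
  by (simp add: borel_algebra_def borel_subsets_def sets_measure_of openin_in_Pow)

lemma borel_subset_space: "B \<in> borel_subsets \<Longrightarrow> B \<subseteq> M"
  using sets.sets_into_space[of B borel_algebra] by simp

lemma mcball_borel: "mcball x r \<in> borel_subsets"
proof -
  have "M - mcball x r \<in> borel_subsets"
    unfolding borel_subsets_def
    by (rule sigma_sets.Basic) (use closedin_mcball[of x r] in \<open>simp add: closedin_def\<close>)
  then have "M - (M - mcball x r) \<in> borel_subsets"
    using sets.compl_sets[of "M - mcball x r" borel_algebra] by simp
  moreover have "M - (M - mcball x r) = mcball x r"
    using mcball_subset_mspace by auto
  ultimately show ?thesis
    by simp
qed

end

context net_tree
begin

section \<open>Paths driven by digit sequences and their limits\<close>

primrec path :: "nat \<Rightarrow> int \<Rightarrow> 'a \<Rightarrow> nat stream \<Rightarrow> 'a"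
  where "path 0 k x \<omega> = x"
  | "path (Suc n) k x \<omega> = path n (k - 1) (child (k - 1) x (shd \<omega>)) (stl \<omega>)"

lemma child_below:
  assumes "x \<in> N k"
  shows child_below_in_net: "child (k - 1) x u \<in> N (k - 1)"
    and parent_child_below: "parent (k - 1) (child (k - 1) x u) = x"
  using child_in_net[of x "k - 1" u] parent_child[of x "k - 1" u] assms by simp_all

lemma path_in_net: "x \<in> N k \<Longrightarrow> path n k x \<omega> \<in> N (k - int n)"
proof (induction n arbitrary: k x \<omega>)
  case (Suc n)
  from Suc.IH[OF child_below_in_net[OF Suc.prems]] show ?case
    by (simp add: algebra_simps)
qed simp

lemma path_in_space: "x \<in> N k \<Longrightarrow> path n k x \<omega> \<in> M"
  by (rule net_in_space[OF path_in_net])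

lemma path_add: "path (m + n) k x \<omega> = path n (k - int m) (path m k x \<omega>) (sdrop m \<omega>)"
  by (induction m arbitrary: k x \<omega>) (simp_all add: algebra_simps)

text \<open>The steps form a geometric series with first term at most \<open>scale k\<close> and
  ratio 1/10. In the induction this reads
  \<open>scale k + 2 * scale (k - 1) = 1.2 * scale k\<close>.\<close>

lemma dist_path_le: "x \<in> N k \<Longrightarrow> d x (path n k x \<omega>) \<le> 2 * scale k"
proof (induction n arbitrary: k x \<omega>)
  case 0
  then show ?case
    using net_in_space[OF 0] by simp
next
  case (Suc n)
  define y where "y = child (k - 1) x (shd \<omega>)"
  have y: "y \<in> N (k - 1)" "parent (k - 1) y = x"
    unfolding y_def using Suc.prems by (rule child_below)+
  have "d x (path (Suc n) k x \<omega>) \<le> d x y + d y (path n (k - 1) y (stl \<omega>))"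
    unfolding path.simps y_def[symmetric]
    using Suc.prems y(1) by (intro triangle net_in_space[OF Suc.prems] net_in_space[OF y(1)] path_in_space)
  also have "d x y \<le> scale k"
    using parent_dist[OF y(1)] commute[of x y] y(2) by simp
  also have "d y (path n (k - 1) y (stl \<omega>)) \<le> 2 * scale (k - 1)"
    using y(1) by (rule Suc.IH)
  also have "scale k + 2 * scale (k - 1) \<le> 2 * scale k"
    using scale_pos[of k] unfolding scale_diff_one by linarith
  finally show ?case
    by simp
qed

definition proj :: "int \<Rightarrow> 'a \<Rightarrow> nat stream \<Rightarrow> 'a"
  where "proj k x \<omega> = (SOME l. limitin mtopology (\<lambda>n. path n k x \<omega>) l sequentially)"

text \<open>From step \<open>n0\<close> on, the path stays within
  \<open>2 * scale (k - int n0)\<close> of its point at step \<open>n0\<close>.\<close>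

lemma MCauchy_path:
  assumes "x \<in> N k"
  shows "MCauchy (\<lambda>n. path n k x \<omega>)"
  unfolding MCauchy_def
proof (intro conjI allI impI)
  show "range (\<lambda>n. path n k x \<omega>) \<subseteq> M"
    using path_in_space[OF assms] by (rule image_subsetI)
  fix \<epsilon> :: real assume "0 < \<epsilon>"
  then obtain n0 where n0: "(1 / 10) ^ n0 < \<epsilon> / (4 * scale k)"
    using real_arch_pow_inv[of "\<epsilon> / (4 * scale k)" "1 / 10"] by auto
  then have \<epsilon>: "4 * scale (k - int n0) < \<epsilon>"
    by (simp add: scale_diff_nat field_simps)
  define p where "p = path n0 k x \<omega>"
  have p: "p \<in> N (k - int n0)"
    unfolding p_def using assms by (rule path_in_net)
  have near: "d p (path n k x \<omega>) \<le> 2 * scale (k - int n0)" if "n0 \<le> n" for n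
    using dist_path_le[OF p, of "n - n0" "sdrop n0 \<omega>"] path_add[of n0 "n - n0" k x \<omega>] that
    by (simp add: p_def)
  have "d (path n k x \<omega>) (path n' k x \<omega>) < \<epsilon>" if "n0 \<le> n" "n0 \<le> n'" for n n'
  proof -
    have "d (path n k x \<omega>) (path n' k x \<omega>) \<le> d (path n k x \<omega>) p + d p (path n' k x \<omega>)"
      by (intro triangle path_in_space[OF assms] net_in_space[OF p])
    also have "\<dots> \<le> 4 * scale (k - int n0)"
      using near[OF that(1)] near[OF that(2)] commute[of p "path n k x \<omega>"] by linarith
    finally show ?thesis
      using \<epsilon> by linarith
  qed
  then show "\<exists>n0. \<forall>n n'. n0 \<le> n \<longrightarrow> n0 \<le> n' \<longrightarrow> d (path n k x \<omega>) (path n' k x \<omega>) < \<epsilon>"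
    by blast
qed

lemma path_tendsto_proj:
  assumes "x \<in> N k"
  shows "limitin mtopology (\<lambda>n. path n k x \<omega>) (proj k x \<omega>) sequentially"
  unfolding proj_def using complete MCauchy_path[OF assms] unfolding mcomplete_def by (meson someI_ex)

lemma proj_in_space: "x \<in> N k \<Longrightarrow> proj k x \<omega> \<in> M"
  using path_tendsto_proj[of x k \<omega>] by (simp add: limitin_metric)

lemma eventually_path_near_proj:
  assumes "x \<in> N k" "0 < \<epsilon>"
  shows "\<forall>\<^sub>F n in sequentially. d (path n k x \<omega>) (proj k x \<omega>) < \<epsilon>"
proof -
  have "\<forall>\<^sub>F n in sequentially. path n k x \<omega> \<in> M \<and> d (path n k x \<omega>) (proj k x \<omega>) < \<epsilon>"
    using path_tendsto_proj[OF assms(1), of \<omega>] assms(2) unfolding limitin_metric by (elim conjE allE impE)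
  then show ?thesis
    by (rule eventually_mono) (erule conjunct2)
qed

lemma dist_proj_le:
  assumes "x \<in> N k"
  shows "d x (proj k x \<omega>) \<le> 2 * scale k"
proof (rule field_le_epsilon)
  fix \<epsilon> :: real assume "0 < \<epsilon>"
  then obtain n where n: "d (path n k x \<omega>) (proj k x \<omega>) < \<epsilon>"
    using eventually_path_near_proj[OF assms] unfolding eventually_sequentially by (meson order_refl)
  have "d x (proj k x \<omega>) \<le> d x (path n k x \<omega>) + d (path n k x \<omega>) (proj k x \<omega>)"
    using assms by (intro triangle net_in_space[OF assms] path_in_space proj_in_space)
  then show "d x (proj k x \<omega>) \<le> 2 * scale k + \<epsilon>"
    using n dist_path_le[OF assms, of n \<omega>] by linarith
qed

text \<open>Dropping the first point of a path does not change its limit. This identity lets the law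
  be computed by conditioning on the first digit.\<close>

lemma proj_step:
  assumes "x \<in> N k"
  shows "proj k x \<omega> = proj (k - 1) (child (k - 1) x (shd \<omega>)) (stl \<omega>)"
proof (rule limitin_metric_unique)
  show "limitin mtopology (\<lambda>n. path (n + 1) k x \<omega>) (proj k x \<omega>) sequentially"
    using path_tendsto_proj[OF assms] by (rule limitin_sequentially_offset)
  show "limitin mtopology (\<lambda>n. path (n + 1) k x \<omega>)
      (proj (k - 1) (child (k - 1) x (shd \<omega>)) (stl \<omega>)) sequentially"
    using path_tendsto_proj[OF child_below_in_net[OF assms], of "shd \<omega>" "stl \<omega>"] by simp
qed simp

section \<open>Independent uniform digits and the law of the limit point\<close>

definition paths :: "nat stream measure"
  where "paths = stream_space (measure_pmf (pmf_of_set {..<K}))"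

lemma space_paths [simp]: "space paths = UNIV"
  by (simp add: paths_def space_stream_space)

lemma prob_space_paths: "prob_space paths"
  unfolding paths_def by (rule prob_space.prob_space_stream_space[OF measure_pmf.prob_space_axioms])

lemma measurable_path: "path n k x \<in> measurable paths (count_space UNIV)"
proof (induction n arbitrary: k x)
  case 0
  then show ?case
    by simp
next
  case (Suc n)
  have stl: "stl \<in> measurable paths paths"
    unfolding paths_def by measurable
  have "shd \<in> measurable paths (measure_pmf (pmf_of_set {..<K}))"
    unfolding paths_def by measurable
  then have "shd \<in> measurable paths (count_space UNIV)"
    by (simp add: measurable_def)
  \<comment> \<open>The first digit takes countably many values, so measurability of the rest of the
    path for each fixed value suffices.\<close>
  then show ?case
    unfolding path.simps
    by (rule measurable_compose_countable[rotated]) (rule measurable_compose[OF stl Suc.IH])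
qed

text \<open>
  An open set \<open>U\<close> contains the limit of a sequence iff, for some \<open>j\<close>, almost all terms of the
  sequence are at distance at least \<open>1 / (j + 1)\<close> from the complement of \<open>U\<close>.
\<close>

lemma measurable_proj:
  assumes "x \<in> N k"
  shows "proj k x \<in> measurable paths borel_algebra"
  unfolding borel_algebra_def
proof (rule measurable_measure_of[OF openin_in_Pow])
  show "proj k x \<in> space paths \<rightarrow> M"
    using proj_in_space[OF assms] by (rule Pi_I)
  fix U assume "U \<in> {U. openin mtopology U}"
  then have U: "openin mtopology U"
    by simp
  define V where "V j = {y. mball y (1 / Suc j) \<subseteq> U}" for j :: nat
  have "proj k x \<omega> \<in> U \<longleftrightarrow> (\<exists>j n0. \<forall>n\<ge>n0. path n k x \<omega> \<in> V j)" for \<omega>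
  proof
    assume "proj k x \<omega> \<in> U"
    then obtain r where r: "0 < r" "mball (proj k x \<omega>) r \<subseteq> U"
      using U unfolding openin_mtopology by (elim conjE allE impE exE)
    obtain j where j: "1 / real (Suc j) < r / 2"
      using nat_approx_posE[of "r / 2"] r(1) by auto
    have "\<forall>\<^sub>F n in sequentially. path n k x \<omega> \<in> V j"
    proof (rule eventually_mono[OF eventually_path_near_proj[OF assms, of "r / 2" \<omega>]])
      show "0 < r / 2"
        using r by simp
      fix n assume n: "d (path n k x \<omega>) (proj k x \<omega>) < r / 2"
      have "mball (path n k x \<omega>) (1 / Suc j) \<subseteq> mball (proj k x \<omega>) r"
      proof
        fix z assume z: "z \<in> mball (path n k x \<omega>) (1 / Suc j)"
        then have "d (proj k x \<omega>) z \<le> d (proj k x \<omega>) (path n k x \<omega>) + d (path n k x \<omega>) z"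
          by (intro triangle proj_in_space path_in_space assms) simp
        then show "z \<in> mball (proj k x \<omega>) r"
          using z n j proj_in_space[OF assms, of \<omega>] commute[of "proj k x \<omega>" "path n k x \<omega>"] by simp
      qed
      then show "path n k x \<omega> \<in> V j"
        using r(2) unfolding V_def by simp
    qed
    then show "\<exists>j n0. \<forall>n\<ge>n0. path n k x \<omega> \<in> V j"
      unfolding eventually_sequentially by (rule exI)
  next
    assume "\<exists>j n0. \<forall>n\<ge>n0. path n k x \<omega> \<in> V j"
    then obtain j n0 where j: "\<forall>n\<ge>n0. path n k x \<omega> \<in> V j"
      by (elim exE)
    have "0 < 1 / real (Suc j)"
      by simp
    from eventually_path_near_proj[OF assms this, of \<omega>] obtain n1
      where n1: "\<forall>n\<ge>n1. d (path n k x \<omega>) (proj k x \<omega>) < 1 / real (Suc j)"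
      unfolding eventually_sequentially by (elim exE)
    have "mball (path (max n0 n1) k x \<omega>) (1 / Suc j) \<subseteq> U"
      using j unfolding V_def by simp
    moreover have "proj k x \<omega> \<in> mball (path (max n0 n1) k x \<omega>) (1 / Suc j)"
      using n1 proj_in_space[OF assms] path_in_space[OF assms] by simp
    ultimately show "proj k x \<omega> \<in> U"
      by (rule subsetD)
  qed
  then have eq: "proj k x -` U \<inter> space paths = {\<omega> \<in> space paths. \<exists>j n0. \<forall>n\<ge>n0. path n k x \<omega> \<in> V j}"
    by auto
  have [measurable]: "{\<omega> \<in> space paths. path n k x \<omega> \<in> V j} \<in> sets paths" for n j
    using measurable_sets[OF measurable_path, of "V j" n k x] by (simp add: vimage_def)
  show "proj k x -` U \<inter> space paths \<in> sets paths"
    unfolding eq by measurable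
qed

definition law :: "int \<Rightarrow> 'a \<Rightarrow> 'a measure"
  where "law k x = distr paths borel_algebra (proj k x)"

lemma sets_law [simp]: "sets (law k x) = borel_subsets"
  by (simp add: law_def)

lemma emeasure_law:
  assumes "x \<in> N k" "B \<in> borel_subsets"
  shows "emeasure (law k x) B = emeasure paths {\<omega>. proj k x \<omega> \<in> B}"
  unfolding law_def using assms by (subst emeasure_distr) (simp_all add: measurable_proj vimage_def)

lemma emeasure_law_eq_one:
  assumes "x \<in> N k" "B \<in> borel_subsets" "mcball x (2 * scale k) \<subseteq> B"
  shows "emeasure (law k x) B = 1"
proof -
  have "proj k x \<omega> \<in> B" for \<omega>
    using dist_proj_le[OF assms(1)] proj_in_space[OF assms(1)] net_in_space[OF assms(1)]
    by (intro subsetD[OF assms(3)]) simp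
  then show ?thesis
    using prob_space.emeasure_space_1[OF prob_space_paths] by (simp add: emeasure_law[OF assms(1,2)])
qed

lemma emeasure_law_le_one: "x \<in> N k \<Longrightarrow> B \<in> borel_subsets \<Longrightarrow> emeasure (law k x) B \<le> 1"
  by (simp add: emeasure_law prob_space.emeasure_le_1[OF prob_space_paths])

lemma emeasure_law_eq_zero:
  assumes "x \<in> N k" "B \<in> borel_subsets" "B \<inter> mcball x (2 * scale k) = {}"
  shows "emeasure (law k x) B = 0"
proof -
  have "proj k x \<omega> \<notin> B" for \<omega>
  proof -
    have "proj k x \<omega> \<in> mcball x (2 * scale k)"
      using dist_proj_le[OF assms(1)] proj_in_space[OF assms(1)] net_in_space[OF assms(1)] by simp
    then show ?thesis
      using assms(3) by blast
  qed
  then show ?thesis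
    by (simp add: emeasure_law[OF assms(1,2)])
qed

text \<open>Condition on the first digit \<open>u\<close>: the remaining digits are again
  independent and uniform, and by \<open>proj_step\<close> they drive the walk from the selected
  child.\<close>

lemma emeasure_law_digits:
  assumes "x \<in> N k" "B \<in> borel_subsets"
  shows "emeasure (law k x) B = (\<Sum>u<K. emeasure (law (k - 1) (child (k - 1) x u)) B) / K"
proof -
  have ne: "{..<K} \<noteq> {}"
    using K_pos by auto
  have meas: "{\<omega>. proj k x \<omega> \<in> B} \<in> sets paths"
    using measurable_sets[OF measurable_proj[OF assms(1)], of B] assms(2) by (simp add: vimage_def)
  have "emeasure (law k x) B = emeasure paths {\<omega>. proj k x \<omega> \<in> B}"
    using assms by (rule emeasure_law)
  also have "\<dots> = (\<integral>\<^sup>+u. emeasure paths {\<omega> \<in> space paths. u ## \<omega> \<in> {\<omega>. proj k x \<omega> \<in> B}}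
      \<partial>measure_pmf (pmf_of_set {..<K}))"
    using meas unfolding paths_def
    by (rule prob_space.emeasure_stream_space[OF measure_pmf.prob_space_axioms])
  also have "\<dots> = (\<integral>\<^sup>+u. emeasure (law (k - 1) (child (k - 1) x u)) B \<partial>measure_pmf (pmf_of_set {..<K}))"
    using assms by (intro nn_integral_cong) (simp add: proj_step[OF assms(1)] emeasure_law child_below_in_net)
  also have "\<dots> = (\<Sum>u<K. emeasure (law (k - 1) (child (k - 1) x u)) B) / K"
    using nn_integral_pmf_of_set[OF ne] by simp
  finally show ?thesis .
qed

text \<open>The sum over digits is grouped by the child that each digit selects.\<close>

lemma emeasure_law_children:
  assumes "y \<in> N (k + 1)" "B \<in> borel_subsets"
  shows "emeasure (law (k + 1) y) B = (\<Sum>x\<in>children k y. ennreal (prob k x) * emeasure (law k x) B)"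
proof -
  have "emeasure (law (k + 1) y) B = (\<Sum>u<K. emeasure (law k (child k y u)) B) / K"
    using emeasure_law_digits[OF assms] by simp
  also have "(\<Sum>u<K. emeasure (law k (child k y u)) B) =
      (\<Sum>x\<in>children k y. \<Sum>u\<in>{u \<in> {..<K}. child k y u = x}. emeasure (law k (child k y u)) B)"
    using finite_children[OF assms(1)] child_in_children[OF assms(1)]
    by (intro sum.group[symmetric]) auto
  also have "\<dots> = (\<Sum>x\<in>children k y. of_nat (card {u \<in> {..<K}. child k y u = x}) * emeasure (law k x) B)"
    by (intro sum.cong refl) simp
  also have "\<dots> / K = (\<Sum>x\<in>children k y. of_nat (card {u \<in> {..<K}. child k y u = x}) * emeasure (law k x) B / K)"
    by (simp add: divide_ennreal_def sum_distrib_right)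
  also have "\<dots> = (\<Sum>x\<in>children k y. ennreal (prob k x) * emeasure (law k x) B)"
  proof (intro sum.cong refl)
    fix x assume "x \<in> children k y"
    then have "ennreal (prob k x) = of_nat (card {u \<in> {..<K}. child k y u = x}) / of_nat K"
      using K_pos by (simp add: children_def prob_def ennreal_of_nat_eq_real_of_nat divide_ennreal)
    then show "of_nat (card {u \<in> {..<K}. child k y u = x}) * emeasure (law k x) B / K =
        ennreal (prob k x) * emeasure (law k x) B"
      by (simp add: divide_ennreal_def mult_ac)
  qed
  finally show ?thesis .
qed

section \<open>Decomposition of a law over the descendants at a lower level\<close>

definition descendants :: "nat \<Rightarrow> int \<Rightarrow> 'a \<Rightarrow> 'a set"
  where "descendants n k y = {x \<in> N k. anc n k x = y}"

lemma descendants_Suc: "descendants (Suc n) k y = (\<Union>z\<in>descendants n (k + 1) y. children k z)"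
  by (auto simp: descendants_def children_def parent_in_net)

lemma finite_descendants:
  assumes "y \<in> N (k + int n)"
  shows "finite (descendants n k y)"
  using assms
proof (induction n arbitrary: k)
  case 0
  have "descendants 0 k y \<subseteq> {y}"
    by (auto simp: descendants_def)
  then show ?case
    by (rule finite_subset) simp
next
  case (Suc n)
  then have "finite (descendants n (k + 1) y)"
    by (simp add: algebra_simps)
  then show ?case
    unfolding descendants_Suc by (intro finite_UN_I finite_children) (simp_all add: descendants_def)
qed

text \<open>The one-level formula is iterated; along each branch the probabilities multiply to the
  weight.\<close>

lemma emeasure_law_descendants:
  assumes "y \<in> N (k + int n)" "B \<in> borel_subsets"
  shows "emeasure (law (k + int n) y) B =
    (\<Sum>x\<in>descendants n k y. ennreal (weight n k x) * emeasure (law k x) B)"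
  using assms(1)
proof (induction n arbitrary: k)
  case 0
  then have "descendants 0 k y = {y}"
    by (auto simp: descendants_def)
  then show ?case
    by simp
next
  case (Suc n)
  have eq: "k + 1 + int n = k + int (Suc n)"
    by simp
  have y: "y \<in> N (k + 1 + int n)"
    using Suc.prems by (simp only: eq)
  let ?h = "\<lambda>x. ennreal (weight (Suc n) k x) * emeasure (law k x) B"
  have "emeasure (law (k + int (Suc n)) y) B =
      (\<Sum>z\<in>descendants n (k + 1) y. ennreal (weight n (k + 1) z) * emeasure (law (k + 1) z) B)"
    using Suc.IH[OF y] by (simp only: eq)
  also have "\<dots> = (\<Sum>z\<in>descendants n (k + 1) y. sum ?h {x \<in> descendants (Suc n) k y. parent k x = z})"
  proof (intro sum.cong refl)
    fix z assume z: "z \<in> descendants n (k + 1) y"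
    then have zN: "z \<in> N (k + 1)"
      by (simp add: descendants_def)
    have set_eq: "{x \<in> descendants (Suc n) k y. parent k x = z} = children k z"
      using z by (auto simp: descendants_def children_def)
    have "ennreal (weight n (k + 1) z) * emeasure (law (k + 1) z) B =
        (\<Sum>x\<in>children k z. ennreal (weight n (k + 1) z) * (ennreal (prob k x) * emeasure (law k x) B))"
      by (simp add: emeasure_law_children[OF zN assms(2)] sum_distrib_left)
    also have "\<dots> = sum ?h (children k z)"
    proof (intro sum.cong refl)
      fix x assume "x \<in> children k z"
      then have x: "x \<in> N k" "parent k x = z"
        by (simp_all add: children_def)
      have "ennreal (weight (Suc n) k x) = ennreal (prob k x) * ennreal (weight n (k + 1) z)"
        using less_imp_le[OF prob_pos[OF x(1)]] weight_nonneg[OF zN, of n] by (simp add: x(2) ennreal_mult)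
      then show "ennreal (weight n (k + 1) z) * (ennreal (prob k x) * emeasure (law k x) B) = ?h x"
        by (simp only: mult_ac)
    qed
    finally show "ennreal (weight n (k + 1) z) * emeasure (law (k + 1) z) B =
        sum ?h {x \<in> descendants (Suc n) k y. parent k x = z}"
      unfolding set_eq .
  qed
  \<comment> \<open>Each descendant at level \<open>k\<close> is counted once, under its
    parent.\<close>
  also have "\<dots> = sum ?h (descendants (Suc n) k y)"
    using finite_descendants[OF y] finite_descendants[OF Suc.prems]
    by (intro sum.group) (auto simp: descendants_def parent_in_net)
  finally show ?case .
qed

end


section \<open>The doubling measure\<close>

text \<open>Every subset of \<open>M\<close> has a measurable hull attaining its outer measure,
  which gives Borel regularity. For the Caratheodory condition, a hull of \<open>A\<close> is split
  along \<open>E\<close> in one direction, and hulls of the two parts of \<open>A\<close> are united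
  in the other.\<close>

lemma (in Metric_space) borel_regular_outer_measure_of:
  assumes sets: "sets \<nu> = borel_subsets" and space: "space \<nu> = M"
  shows "borel_regular_outer_measure (outer_measure_of \<nu>)"
proof -
  let ?f = "outer_measure_of \<nu>"
  have hull: "\<exists>E\<in>sets \<nu>. A \<subseteq> E \<and> ?f A = emeasure \<nu> E" if "A \<subseteq> M" for A
    using that by (intro outer_measure_of_attain) (simp add: space)
  have f_le: "?f A \<le> emeasure \<nu> E" if "A \<subseteq> E" "E \<in> sets \<nu>" for A E
    using outer_measure_of_mono[OF that(1), of \<nu>] outer_measure_of_eq[OF that(2)] by simp
  have sub: "countably_subadditive (Pow M) ?f"
    unfolding countably_subadditive_def
  proof (intro allI impI)
    fix A :: "nat \<Rightarrow> 'a set" assume A: "range A \<subseteq> Pow M"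
    have "\<exists>E. E \<in> sets \<nu> \<and> A i \<subseteq> E \<and> ?f (A i) = emeasure \<nu> E" for i
      using hull[of "A i"] A by (simp add: Bex_def image_subset_iff)
    then have "\<forall>i. \<exists>E. E \<in> sets \<nu> \<and> A i \<subseteq> E \<and> ?f (A i) = emeasure \<nu> E"
      by (rule allI)
    from choice[OF this] obtain E where E: "\<forall>i. E i \<in> sets \<nu> \<and> A i \<subseteq> E i \<and> ?f (A i) = emeasure \<nu> (E i)"
      by (elim exE)
    then have range_E: "range E \<subseteq> sets \<nu>"
      by (simp add: image_subset_iff)
    have "(\<Union>i. A i) \<subseteq> (\<Union>i. E i)"
      using E by (intro UN_mono) simp_all
    then have "?f (\<Union>i. A i) \<le> emeasure \<nu> (\<Union>i. E i)"
      using range_E by (intro f_le sets.countable_UN)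
    also have "\<dots> \<le> (\<Sum>i. emeasure \<nu> (E i))"
      using range_E by (rule emeasure_subadditive_countably)
    also have "\<dots> = (\<Sum>i. ?f (A i))"
      using E by simp
    finally show "?f (\<Union>i. A i) \<le> (\<Sum>i. ?f (A i))" .
  qed
  have "E \<in> lambda_system M (Pow M) ?f" if E: "E \<in> borel_subsets" for E
  proof -
    have E_sets: "E \<in> sets \<nu>" "M - E \<in> sets \<nu>"
      using E sets sets.compl_sets[of E \<nu>] by (simp_all add: space)
    have "?f (E \<inter> A) + ?f ((M - E) \<inter> A) = ?f A" if A: "A \<subseteq> M" for A
    proof (rule antisym)
      from hull[OF A] obtain H where H: "H \<in> sets \<nu>" "A \<subseteq> H" "?f A = emeasure \<nu> H"
        by (elim bexE conjE)
      have "?f (E \<inter> A) + ?f ((M - E) \<inter> A) \<le> emeasure \<nu> (E \<inter> H) + emeasure \<nu> ((M - E) \<inter> H)"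
        using H E_sets by (intro add_mono f_le) auto
      also have "\<dots> = emeasure \<nu> ((E \<inter> H) \<union> ((M - E) \<inter> H))"
        using H E_sets by (intro plus_emeasure) auto
      also have "(E \<inter> H) \<union> ((M - E) \<inter> H) = H"
        using sets.sets_into_space[OF H(1)] by (auto simp: space)
      finally show "?f (E \<inter> A) + ?f ((M - E) \<inter> A) \<le> ?f A"
        using H by simp
      from hull[OF le_infI2[OF A, of E]]
      obtain C where C: "C \<in> sets \<nu>" "E \<inter> A \<subseteq> C" "?f (E \<inter> A) = emeasure \<nu> C"
        by (elim bexE conjE)
      from hull[OF le_infI2[OF A, of "M - E"]]
      obtain D where D: "D \<in> sets \<nu>" "(M - E) \<inter> A \<subseteq> D" "?f ((M - E) \<inter> A) = emeasure \<nu> D"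
        by (elim bexE conjE)
      have "?f A \<le> emeasure \<nu> (C \<union> D)"
        using A C D by (intro f_le) auto
      also have "\<dots> \<le> emeasure \<nu> C + emeasure \<nu> D"
        using C D by (intro emeasure_subadditive)
      finally show "?f A \<le> ?f (E \<inter> A) + ?f ((M - E) \<inter> A)"
        using C D by simp
    qed
    then show ?thesis
      using E borel_subset_space unfolding lambda_system_def by simp
  qed
  then have "borel_subsets \<subseteq> lambda_system M (Pow M) ?f"
    by (rule subsetI)
  moreover have "\<exists>B\<in>borel_subsets. A \<subseteq> B \<and> ?f B = ?f A" if "A \<subseteq> M" for A
  proof -
    from hull[OF that] obtain E where "E \<in> sets \<nu>" "A \<subseteq> E" "?f A = emeasure \<nu> E"
      by (elim bexE conjE)
    then show ?thesis
      using sets by (intro bexI[of _ E]) simp_all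
  qed
  moreover have "outer_measure_space (Pow M) ?f"
    using sub unfolding outer_measure_space_def positive_def increasing_def
    by (simp add: outer_measure_of_mono)
  ultimately show ?thesis
    unfolding borel_regular_outer_measure_def by (intro conjI allI impI)
qed

section \<open>The renormalised laws and their increasing limit\<close>

context net_tree
begin

text \<open>This is the reciprocal of \<open>weight j 0 x0\<close>, so in every approximation the
  walk passes through \<open>x0\<close> at level 0 with total mass 1.\<close>

primrec mass :: "nat \<Rightarrow> real"
  where "mass 0 = 1"
  | "mass (Suc j) = mass j / prob (int j) x0"

text \<open>
  The masses are chosen such that the part of \<open>approx (Suc j)\<close> that descends from \<open>x0\<close> at level \<open>j\<close>
  is \<open>approx j\<close>.
\<close>

definition approx :: "nat \<Rightarrow> 'a set \<Rightarrow> ennreal"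
  where "approx j B = ennreal (mass j) * emeasure (law (int j) x0) B"

definition total :: "'a set \<Rightarrow> ennreal"
  where "total B = (SUP j. approx j B)"

definition limit_measure :: "'a measure"
  where "limit_measure = measure_of M borel_subsets total"

lemma mass_pos: "0 < mass j"
  by (induction j) (simp_all add: prob_pos base_in_net)

text \<open>The child \<open>x0\<close> of \<open>x0\<close> contributes the previous approximation.
  The explicit remainder gives monotonicity and shows which branches bring new mass.\<close>

lemma approx_Suc:
  assumes "B \<in> borel_subsets"
  shows "approx (Suc j) B = approx j B + ennreal (mass (Suc j)) *
    (\<Sum>y\<in>children (int j) x0 - {x0}. ennreal (prob (int j) y) * emeasure (law (int j) y) B)"
proof -
  have p: "0 < prob (int j) x0"
    using base_in_net by (rule prob_pos)
  have "ennreal (mass (Suc j)) * ennreal (prob (int j) x0) = ennreal (mass j)"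
    using p mass_pos[of j] by (simp flip: ennreal_mult)
  then have "ennreal (mass (Suc j)) * (ennreal (prob (int j) x0) * emeasure (law (int j) x0) B) = approx j B"
    by (simp only: approx_def mult.assoc[symmetric])
  moreover have "emeasure (law (int (Suc j)) x0) B =
      ennreal (prob (int j) x0) * emeasure (law (int j) x0) B +
      (\<Sum>y\<in>children (int j) x0 - {x0}. ennreal (prob (int j) y) * emeasure (law (int j) y) B)"
    using emeasure_law_children[OF base_in_net assms, of "int j"]
      sum.remove[OF finite_children[OF base_in_net] self_in_children[OF base_in_net]]
    by (simp add: add.commute)
  ultimately show ?thesis
    unfolding approx_def[of "Suc j"] by (simp only: distrib_left)
qed

lemma incseq_approx: "B \<in> borel_subsets \<Longrightarrow> incseq (\<lambda>j. approx j B)"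
  by (rule incseq_SucI) (simp add: approx_Suc)

lemma emeasure_limit_measure:
  assumes "B \<in> borel_subsets"
  shows "emeasure limit_measure B = total B"
  unfolding limit_measure_def
proof (rule emeasure_measure_of_sigma)
  show "sigma_algebra M borel_subsets"
    using sets.sigma_algebra_axioms[of borel_algebra] by simp
  show "positive borel_subsets total"
    by (simp add: positive_def total_def approx_def)
  show "countably_additive borel_subsets total"
    unfolding countably_additive_def
  proof (intro allI impI)
    fix A :: "nat \<Rightarrow> 'a set" assume A: "range A \<subseteq> borel_subsets" "disjoint_family A"
    \<comment> \<open>Monotonicity in \<open>j\<close> allows the supremum to be interchanged with
      the series.\<close>
    have "(\<Sum>i. total (A i)) = (SUP j. \<Sum>i. approx j (A i))"
      unfolding total_def using A(1) by (intro ennreal_suminf_SUP_eq incseq_approx) auto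
    also have "\<dots> = (SUP j. approx j (\<Union>i. A i))"
      unfolding approx_def using A suminf_emeasure[of A "law (int _) x0"] by (intro SUP_cong refl) simp
    finally show "(\<Sum>i. total (A i)) = total (\<Union>i. A i)"
      by (simp add: total_def)
  qed
qed fact

lemma sets_limit_measure: "sets limit_measure = borel_subsets"
  and space_limit_measure: "space limit_measure = M"
  using sigma_algebra.sets_measure_of_eq[of M borel_subsets total]
    sigma_algebra.space_measure_of_eq[of M borel_subsets total]
    sets.sigma_algebra_axioms[of borel_algebra]
  by (simp_all add: limit_measure_def)

section \<open>The limit measure on balls\<close>

lemma emeasure_law_eq_zero_far:
  assumes "z \<in> M" "B \<in> borel_subsets" "B \<subseteq> mcball z (96 * scale k)"
    and "x \<in> N k" "x \<notin> mcball z (98 * scale k)"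
  shows "emeasure (law k x) B = 0"
proof (rule emeasure_law_eq_zero[OF assms(4,2)])
  note x = net_in_space[OF assms(4)]
  have "y \<notin> mcball x (2 * scale k)" if "y \<in> mcball z (96 * scale k)" for y
  proof
    assume y: "y \<in> mcball x (2 * scale k)"
    have "d z x \<le> d z y + d y x"
      using y assms(1) by (intro triangle) simp_all
    \<comment> \<open>Limits of the walk from \<open>x\<close> stay within
      \<open>2 * scale k\<close> of \<open>x\<close>, and \<open>96 + 2 = 98\<close>.\<close>
    then have "d z x \<le> 98 * scale k"
      using y that commute[of x y] by simp
    then show False
      using assms(1,5) x by simp
  qed
  then show "B \<inter> mcball x (2 * scale k) = {}"
    using assms(3) by blast
qed

text \<open>Finitely many points of \<open>N k\<close> can send mass into the ball, and from some
  common height on all of them descend from \<open>x0\<close>. Later increments come from branches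
  that avoid these points, so the supremum is attained at a finite stage. The same \<open>n\<close>
  and \<open>c\<close> serve all \<open>B\<close>.\<close>

lemma ex_total_eq_sum:
  assumes "z \<in> M"
  shows "\<exists>n c. 0 < c \<and> (\<forall>x \<in> N k \<inter> mcball z (98 * scale k). anc n k x = x0) \<and>
    (\<forall>B\<in>borel_subsets. B \<subseteq> mcball z (96 * scale k) \<longrightarrow>
      total B = ennreal c *
        (\<Sum>x\<in>N k \<inter> mcball z (98 * scale k). ennreal (weight n k x) * emeasure (law k x) B))"
proof -
  define F where "F = N k \<inter> mcball z (98 * scale k)"
  have "mcball z (98 * scale k) \<subseteq> mcball z (100 * scale k)"
    by (intro mcball_subset_concentric mult_right_mono) simp_all
  then have "finite F"
    unfolding F_def using finite_net_ball[OF assms, of k] by (meson Int_mono finite_subset order_refl)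
  then have "\<forall>\<^sub>F n in sequentially. \<forall>x\<in>F. anc n k x = x0"
    by (rule eventually_ball_finite) (simp add: F_def eventually_anc_base)
  then obtain n0 where n0: "\<forall>n\<ge>n0. \<forall>x\<in>F. anc n k x = x0"
    unfolding eventually_sequentially by (elim exE)
  \<comment> \<open>Level \<open>J\<close> lies at least \<open>n0\<close> steps above
    \<open>k\<close>; \<open>nat\<close> truncates at 0 because the approximations start
    there.\<close>
  define J where "J = nat (k + int n0)"
  have level: "k + int (nat (int j - k)) = int j \<and> n0 \<le> nat (int j - k)" if "J \<le> j" for j
    using that unfolding J_def by linarith
  define n where "n = nat (int J - k)"
  have n: "int J = k + int n" "n0 \<le> n"
    using level[of J] by (simp_all add: n_def)
  have "total B = ennreal (mass J) * (\<Sum>x\<in>F. ennreal (weight n k x) * emeasure (law k x) B)"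
    if B: "B \<in> borel_subsets" "B \<subseteq> mcball z (96 * scale k)" for B
  proof -
    have zero: "emeasure (law k x) B = 0" if "x \<in> N k" "x \<notin> F" for x
      using that by (intro emeasure_law_eq_zero_far[OF assms B]) (simp_all add: F_def)
    have step: "approx (Suc j) B = approx j B" if j: "J \<le> j" for j
    proof -
      define m where "m = nat (int j - k)"
      have m: "int j = k + int m" "n0 \<le> m"
        using level[OF j] by (simp_all add: m_def)
      \<comment> \<open>The descendants of a child \<open>y\<close> other than \<open>x0\<close>
        have \<open>y\<close> as ancestor at level \<open>j\<close>, so none of them is in
        \<open>F\<close>, and \<open>B\<close> receives nothing from this branch.\<close>
      have "emeasure (law (int j) y) B = 0" if y: "y \<in> children (int j) x0 - {x0}" for y
      proof -
        have yN: "y \<in> N (k + int m)" "y \<noteq> x0"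
          using y by (simp_all add: children_def m)
        have "emeasure (law k x) B = 0" if x: "x \<in> descendants m k y" for x
        proof (rule zero)
          show "x \<in> N k"
            using x by (simp add: descendants_def)
          show "x \<notin> F"
            using x n0 m(2) yN(2) by (auto simp: descendants_def)
        qed
        then show ?thesis
          unfolding m(1) emeasure_law_descendants[OF yN(1) B(1)] by simp
      qed
      then show ?thesis
        by (simp add: approx_Suc[OF B(1)])
    qed
    have "approx j B \<le> approx J B" for j
    proof (cases "j \<le> J")
      case True
      then show ?thesis
        using incseq_approx[OF B(1)] by (rule incseqD[rotated])
    next
      case False
      then have "J \<le> j"
        by simp
      then have "approx j B = approx J B"
        by (induction j rule: dec_induct) (simp_all add: step)
      then show ?thesis
        by simp
    qed
    then have "total B = approx J B"
      unfolding total_def by (intro antisym SUP_least SUP_upper) simp_all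
    also have "\<dots> = ennreal (mass J) *
        (\<Sum>x\<in>descendants n k x0. ennreal (weight n k x) * emeasure (law k x) B)"
      unfolding approx_def n(1) emeasure_law_descendants[OF base_in_net B(1)] by (rule refl)
    also have "(\<Sum>x\<in>descendants n k x0. ennreal (weight n k x) * emeasure (law k x) B) =
        (\<Sum>x\<in>F. ennreal (weight n k x) * emeasure (law k x) B)"
    proof (rule sum.mono_neutral_right)
      show "finite (descendants n k x0)"
        using base_in_net by (rule finite_descendants)
      show "F \<subseteq> descendants n k x0"
        using n0 n(2) by (auto simp: F_def descendants_def)
      show "\<forall>x\<in>descendants n k x0 - F. ennreal (weight n k x) * emeasure (law k x) B = 0"
        using zero by (simp add: descendants_def)
    qed
    finally show ?thesis .
  qed
  then show ?thesis
    using mass_pos[of J] n0 n(2) unfolding F_def[symmetric] by (intro exI[of _ n] exI[of _ "mass J"]) simp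
qed

text \<open>Both balls are compared with the mass \<open>a * w\<close> of one net point
  \<open>x\<close> near \<open>z\<close>. The smaller ball contains all limits of walks from
  \<open>x\<close>; the larger one is charged by at most \<open>K\<close> net points, each of weight
  at most \<open>K ^ 3 * w\<close>.\<close>

lemma limit_measure_ball_bounds:
  assumes "z \<in> M" "0 < t"
  shows "\<exists>c>0. ennreal c \<le> emeasure limit_measure (mcball z t) \<and>
    emeasure limit_measure (mcball z (2 * t)) \<le> ennreal (real K ^ 4 * c)"
proof -
  \<comment> \<open>Then \<open>4 * scale k\<close> is at most \<open>t\<close>, leaving room for a
    ball of radius \<open>2 * scale k\<close> around \<open>x\<close>, while \<open>2 * t\<close> is
    below \<open>80 * scale k\<close>, within the range 96 of the sum formula.\<close>
  obtain k where k: "scale k \<le> t / 4" "t / 4 < 10 * scale k"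
    using scale_bracket[of "t / 4"] assms(2) by auto
  let ?F = "N k \<inter> mcball z (98 * scale k)"
  from ex_total_eq_sum[OF assms(1), of k] obtain n a where a: "0 < a"
    and anc: "\<forall>x\<in>?F. anc n k x = x0"
    and total: "\<forall>B\<in>borel_subsets. B \<subseteq> mcball z (96 * scale k) \<longrightarrow>
      total B = ennreal a * (\<Sum>x\<in>?F. ennreal (weight n k x) * emeasure (law k x) B)"
    by (elim exE conjE)
  have total': "emeasure limit_measure (mcball z r) =
      ennreal a * (\<Sum>x\<in>?F. ennreal (weight n k x) * emeasure (law k x) (mcball z r))"
    if "r \<le> 96 * scale k" for r
    using total mcball_borel[of z r] mcball_subset_concentric[OF that, of z]
    by (simp add: emeasure_limit_measure)
  from net_cover[OF assms(1), of k] obtain x where x: "x \<in> N k" "d z x \<le> 2 * scale k"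
    by (elim bexE)
  have xF: "x \<in> ?F"
    using x assms(1) net_in_space[OF x(1)] scale_nonneg[of k] by (simp del: scale_nonneg)
  have sub: "?F \<subseteq> N k \<inter> mcball z (100 * scale k)"
    using mcball_subset_concentric[of "98 * scale k" "100 * scale k" z] by auto
  have finF: "finite ?F"
    using sub finite_net_ball[OF assms(1)] by (rule finite_subset)
  have cardF: "card ?F \<le> K"
    using card_mono[OF finite_net_ball[OF assms(1)] sub] card_net_ball[OF assms(1), of k] by linarith
  define w where "w = weight n k x"
  have w: "0 < w"
    unfolding w_def using x(1) by (rule weight_pos)
  have "mcball x (2 * scale k) \<subseteq> mcball z t"
  proof
    fix y assume y: "y \<in> mcball x (2 * scale k)"
    then have "d z y \<le> d z x + d x y"
      using assms(1) by (intro triangle) simp_all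
    then show "y \<in> mcball z t"
      using y x(2) k(1) assms(1) by simp
  qed
  then have "ennreal w = ennreal (weight n k x) * emeasure (law k x) (mcball z t)"
    using emeasure_law_eq_one[OF x(1) mcball_borel] by (simp add: w_def)
  also have "\<dots> \<le> (\<Sum>y\<in>?F. ennreal (weight n k y) * emeasure (law k y) (mcball z t))"
    using finF xF by (intro member_le_sum) simp_all
  finally have "ennreal a * ennreal w \<le> emeasure limit_measure (mcball z t)"
    using k by (subst total') (simp_all add: mult_left_mono)
  then have lower: "ennreal (a * w) \<le> emeasure limit_measure (mcball z t)"
    using a w by (simp add: ennreal_mult)
  have "(\<Sum>y\<in>?F. ennreal (weight n k y) * emeasure (law k y) (mcball z (2 * t))) \<le> (\<Sum>y\<in>?F. ennreal (real K ^ 3 * w))"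
  proof (rule sum_mono)
    fix y assume y: "y \<in> ?F"
    then have yN: "y \<in> N k" and yz: "d z y \<le> 98 * scale k"
      by simp_all
    have "d y x \<le> d y z + d z x"
      using assms(1) by (intro triangle net_in_space[OF yN] net_in_space[OF x(1)])
    \<comment> \<open>\<open>98 + 2 = 100\<close> is the distance covered by
      \<open>weight_comparable\<close>.\<close>
    then have "d y x \<le> 100 * scale k"
      using yz x(2) commute[of y z] by linarith
    then have "weight n k y \<le> real K ^ 3 * w"
      unfolding w_def using yN x(1) anc y xF by (intro weight_comparable) simp_all
    then have "ennreal (weight n k y) * emeasure (law k y) (mcball z (2 * t)) \<le> ennreal (real K ^ 3 * w) * 1"
      using yN by (intro mult_mono emeasure_law_le_one mcball_borel ennreal_leI) simp_all
    then show "ennreal (weight n k y) * emeasure (law k y) (mcball z (2 * t)) \<le> ennreal (real K ^ 3 * w)"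
      by simp
  qed
  also have "\<dots> = of_nat (card ?F) * ennreal (real K ^ 3 * w)"
    by simp
  also have "\<dots> \<le> of_nat K * ennreal (real K ^ 3 * w)"
    using cardF by (intro mult_right_mono) simp_all
  also have "\<dots> = ennreal (real K ^ 4 * w)"
    using w by (simp add: ennreal_of_nat_eq_real_of_nat power_numeral_reduce mult.assoc flip: ennreal_mult)
  finally have "emeasure limit_measure (mcball z (2 * t)) \<le> ennreal a * ennreal (real K ^ 4 * w)"
    using k by (subst total') (simp_all add: mult_left_mono)
  also have "\<dots> = ennreal (real K ^ 4 * (a * w))"
    using a w by (simp add: mult_ac flip: ennreal_mult)
  finally show ?thesis
    using lower a w by (intro exI[of _ "a * w"]) simp
qed

lemma doubling_measure_limit_measure: "doubling_measure (outer_measure_of limit_measure)"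
  unfolding doubling_measure_def
proof (intro conjI exI[of _ "real K ^ 4"] ballI allI impI)
  show "borel_regular_outer_measure (outer_measure_of limit_measure)"
    using sets_limit_measure space_limit_measure by (rule borel_regular_outer_measure_of)
  show K1: "1 \<le> real K ^ 4"
    using K_pos by simp
  fix x and t :: real assume x: "x \<in> M" "0 < t"
  have outer: "outer_measure_of limit_measure (mcball x r) = emeasure limit_measure (mcball x r)" for r
    by (simp add: sets_limit_measure mcball_borel)
  have mono: "emeasure limit_measure (mcball x t) \<le> emeasure limit_measure (mcball x (2 * t))"
    using x(2) by (intro emeasure_mono mcball_subset_concentric) (simp_all add: sets_limit_measure mcball_borel)
  \<comment> \<open>The real number \<open>c\<close> yields positivity from below and finiteness
    from above, besides the doubling inequality.\<close>
  from limit_measure_ball_bounds[OF x] obtain c where c: "0 < c"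
    "ennreal c \<le> emeasure limit_measure (mcball x t)"
    "emeasure limit_measure (mcball x (2 * t)) \<le> ennreal (real K ^ 4 * c)"
    by (elim exE conjE)
  have "0 < ennreal c"
    using c(1) by simp
  also note c(2)
  also note mono
  finally show "0 < outer_measure_of limit_measure (mcball x (2 * t))"
    unfolding outer .
  have "ennreal (real K ^ 4 * c) = ennreal (real K ^ 4) * ennreal c"
    using c(1) by (simp add: ennreal_mult)
  also have "\<dots> \<le> ennreal (real K ^ 4) * emeasure limit_measure (mcball x t)"
    using c(2) by (intro mult_left_mono) simp_all
  finally show "outer_measure_of limit_measure (mcball x (2 * t)) \<le>
      ennreal (real K ^ 4) * outer_measure_of limit_measure (mcball x t)"
    unfolding outer using c(3) by (rule order_trans[rotated])
  have "emeasure limit_measure (mcball x t) < \<infinity>"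
    using order_trans[OF mono c(3)] by (rule le_less_trans) simp
  then show "ennreal (real K ^ 4) * outer_measure_of limit_measure (mcball x t) < \<infinity>"
    unfolding outer by (simp add: ennreal_mult_less_top)
qed

end

theorem theorem3p1:
  fixes X :: "'a set" and d :: "'a \<Rightarrow> 'a \<Rightarrow> real"
  assumes "Metric_space X d"
    and "X \<noteq> {}"
    and "Metric_space.mcomplete X d"
    and "Metric_space.doubling X d"
  shows "\<exists>\<mu>. Metric_space.doubling_measure X d \<mu>"
proof -
  interpret Metric_space X d
    by fact
  obtain x0 where "x0 \<in> X"
    using \<open>X \<noteq> {}\<close> by blast
  from nested_nets[OF this] obtain N where N: "\<forall>k. N k \<subseteq> X \<and> x0 \<in> N k \<and> N (k + 1) \<subseteq> N k \<and>
      separated (scale k) (N k) \<and> (\<forall>x\<in>N k. \<exists>y\<in>N (k + 1). d x y \<le> scale (k + 1)) \<and>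
      (\<forall>x\<in>X. \<exists>y\<in>N k. d x y \<le> 2 * scale k)"
    by (elim exE)
  from doubling_separated_card[OF \<open>doubling\<close>] obtain K where K: "\<forall>r z S. 0 < r \<longrightarrow> z \<in> X \<longrightarrow>
      S \<subseteq> mcball z (100 * r) \<longrightarrow> separated r S \<longrightarrow> finite S \<and> card S \<le> K"
    by (elim exE)
  have "separated (scale k) (N k \<inter> mcball x (100 * scale k))" for k x
    using N by (meson Int_lower1 pairwise_subset)
  \<comment> \<open>The packing bound is applied with \<open>r = scale k\<close>, the separation of
    \<open>N k\<close>.\<close>
  then have ball: "finite (N k \<inter> mcball x (100 * scale k)) \<and> card (N k \<inter> mcball x (100 * scale k)) \<le> K"
    if "x \<in> X" for k x
    using K that scale_pos[of k] Int_lower2[of "N k"] by presburger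
  interpret net_tree X d x0 N K
  proof
    show "mcomplete"
      by fact
  qed (use N ball in simp_all)
  show ?thesis
    by (rule exI[of _ "outer_measure_of limit_measure"]) (rule doubling_measure_limit_measure)
qed

end
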